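(* Let $1\le m<n$, let $M$ be a matroid of rank $m$ on $[n]$, and let $B$ be a basis of $M$ whose vertex figure $\Gamma_B$ is nonempty. Let $\mathcal{S}$ be the regular subdivision of $\Gamma_B$ induced by a matrix $V\in\mathbb{T}^{B\times([n]\setminus B)}$ (so $V_{i,j}$ is finite if and only if $B-i\cup j$ is a basis of $M$). Let $\mathcal{D}$ be the matroid subdivision induced by $\tau_V\in\mathbb{T}^{\binom{[n]}{m}}$ on the matroid polytope $\Gamma'$. Then the posets $\mathcal{I}(\mathcal{S})$ and $\mathcal{I}(\mathcal{D})$ are isomorphic.
   Context: Notation: $[n]=\{1,\dots,n\}$; $\binom{[n]}{m}$ is the set of $m$-element subsets of $[n]$; $\mathbb{T}=\mathbb{R}\cup\{\infty\}$; $S\cup i$, $S-i$ mean $S\cup\{i\}$, $S\setminus\{i\}$; $e_S=\sum_{i\in S}e_i$. The matroid polytope of $M$ is $\Gamma=\mathrm{conv}\{e_A: A\text{ a basis of }M\}\subseteq\mathbb{R}^n$. The vertex figure around $B$ is $\Gamma_B=\mathrm{conv}\{e_A: A\text{ a basis of }M,\ |A\setminus B|=1\}=\mathrm{conv}\{e_B-e_i+e_j : j\in[n]\setminus B,\ i\in I_j\}$, where $I_j=\{i\in B: B-i\cup j\text{ is a basis of }M\}$. It is affinely isomorphic to $\mathrm{conv}\{e_j+\Delta_{I_j}: j\in[n]\setminus B\}$, with $\Delta_I=\mathrm{conv}\{e_i:i\in I\}$, the vertex $e_B-e_i+e_j$ corresponding to $e_i+e_j$. Regular subdivision: given a polytope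 and real heights on its vertices, lift each vertex $x$ with height $h$ to $(x,h)$, take the convex hull, and project its lower faces back. The regular subdivision of $\Gamma_B$ induced by $V$ is obtained by giving the vertex $e_B-e_i+e_j$ ($j\in[n]\setminus B$, $i\in I_j$) height $V_{i,j}$; the entries of $V$ with $i\notin I_j$ are $\infty$. Let $\bar V\in\mathbb{T}^{B\times[n]}$ be the augmented matrix whose columns indexed by $[n]\setminus B$ form $V$ and whose columns indexed by $B$ form the tropical identity matrix ($\bar V_{b,b}=0$, and $\bar V_{b,b'}=\infty$ for $b\ne b'$ in $B$). Define $\tau_V\in\mathbb{T}^{\binom{[n]}{m}}$ by the tropical maximal minors $(\tau_V)_A=\min_\sigma\sum_{a\in A}\bar V_{\sigma(a),a}$, the minimum over all bijections $\sigma:A\to B$. The set $\{A:(\tau_V)_A\neq\infty\}$ is the set of bases of a matroid $M'$ on $[n]$ (a principal transversal matroid), and $\Gamma'=\mathrm{conv}\{e_A:(\tau_V)_A\ne\infty\}$ is its matroid polytope; $\Gamma'$ has the same vertex figure around $B$ as $\Gamma$. $\mathcal{D}$ is the regular subdivision of $\Gamma'$ obtained by giving $e_A$ height $(\tau_V)_A$; all its faces are matroid polytopes. For a polyhedral subdivision $\Sigma$ of a polytope $P$, $\mathcal{I}(\Sigma)$ is the poset of interior faces of $\Sigma$ (faces not contained in the relative boundary of $P$), ordered by reverse inclusion. *)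

theory Defs
  imports "HOL-Analysis.Analysis"
begin

text \<open>
  The ground set \<open>[n]\<close> is the universe of a finite type \<open>'n\<close> with \<open>n = CARD('n)\<close>, and
  \<open>\<real>\<^sup>n\<close> is \<open>real ^ 'n\<close>.  The tropical numbers are the values \<open>\<noteq> -\<infinity>\<close> of type \<open>ereal\<close>.
\<close>

definition matroid_bases :: "nat \<Rightarrow> 'n::finite set set \<Rightarrow> bool" where
  "matroid_bases m \<B> \<longleftrightarrow>
     \<B> \<noteq> {} \<and> (\<forall>A\<in>\<B>. card A = m) \<and>
     (\<forall>A\<in>\<B>. \<forall>A'\<in>\<B>. \<forall>a\<in>A - A'. \<exists>a'\<in>A' - A. insert a' (A - {a}) \<in> \<B>)"

definition indicator_vec :: "'n::finite set \<Rightarrow> real ^ 'n" where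
  "indicator_vec S = (\<Sum>i\<in>S. axis i 1)"

definition matroid_polytope :: "'n::finite set set \<Rightarrow> (real ^ 'n) set" where
  "matroid_polytope \<B> = convex hull (indicator_vec ` \<B>)"

definition vertex_figure :: "'n::finite set set \<Rightarrow> 'n set \<Rightarrow> (real ^ 'n) set" where
  "vertex_figure \<B> B = convex hull (indicator_vec ` {A \<in> \<B>. card (A - B) = 1})"

definition exchange_pairs :: "'n::finite set set \<Rightarrow> 'n set \<Rightarrow> ('n \<times> 'n) set" where
  "exchange_pairs \<B> B = {(i, j). j \<notin> B \<and> i \<in> B \<and> insert j (B - {i}) \<in> \<B>}"

definition exchange_vertex :: "'n::finite set \<Rightarrow> 'n \<times> 'n \<Rightarrow> real ^ 'n" where
  "exchange_vertex B = (\<lambda>(i, j). indicator_vec B - axis i 1 + axis j 1)"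

lemma vertex_figure_eq_exchange:
  assumes "matroid_bases m \<B>" "B \<in> \<B>"
  shows "vertex_figure \<B> B = convex hull (exchange_vertex B ` exchange_pairs \<B> B)"
proof -
  have vec: "indicator_vec (insert j (B - {i})) = exchange_vertex B (i, j)"
    if "i \<in> B" "j \<notin> B" for i j
    using that by (simp add: indicator_vec_def exchange_vertex_def sum_diff1)
  have "\<exists>i j. i \<in> B \<and> j \<notin> B \<and> A = insert j (B - {i})"
    if A: "A \<in> \<B>" "card (A - B) = 1" for A
  proof -
    have "card A = card B"
      using assms A by (auto simp: matroid_bases_def)
    then have "card (B - A) = 1"
      using A(2) card_Diff_subset_Int[of A B] card_Diff_subset_Int[of B A]
        card_mono[of A "A \<inter> B"] card_mono[of B "A \<inter> B"]
      by (simp add: Int_commute)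
    then obtain i j where "B - A = {i}" "A - B = {j}"
      using A(2) by (metis card_1_singletonE)
    then show ?thesis by blast
  qed
  moreover have "card (insert j (B - {i}) - B) = 1" if "j \<notin> B" for i j
  proof -
    have "insert j (B - {i}) - B = {j}" using that by auto
    then show ?thesis by simp
  qed
  ultimately have "indicator_vec ` {A \<in> \<B>. card (A - B) = 1} = exchange_vertex B ` exchange_pairs \<B> B"
    using vec unfolding exchange_pairs_def by (fastforce simp: image_iff)
  then show ?thesis by (simp add: vertex_figure_def)
qed

text \<open>
  A lower face is one cut out by a supporting hyperplane whose inner normal \<open>(u, 1)\<close> has positive
  last coordinate.  The empty face is included.
\<close>
definition lower_faces :: "('a::euclidean_space \<times> real) set \<Rightarrow> ('a \<times> real) set set" where
  "lower_faces P = {F. \<exists>u c. (\<forall>z\<in>P. c \<le> (u, 1) \<bullet> z) \<and> F = {z \<in> P. (u, 1) \<bullet> z = c}}"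

text \<open>
  The points carrying heights are given as a family \<open>p\<close> over an index set \<open>I\<close>; the result is the
  set of all cells of the subdivision of \<open>convex hull (p ` I)\<close>, of every dimension.
\<close>
definition regular_subdivision ::
    "'i set \<Rightarrow> ('i \<Rightarrow> 'a::euclidean_space) \<Rightarrow> ('i \<Rightarrow> real) \<Rightarrow> 'a set set" where
  "regular_subdivision I p h =
     (\<lambda>F. fst ` F) ` lower_faces (convex hull ((\<lambda>i. (p i, h i)) ` I))"

text \<open>The empty cell lies in every relative boundary, so it is never an interior face.\<close>
definition interior_faces :: "'a::euclidean_space set \<Rightarrow> 'a set set \<Rightarrow> 'a set set" where
  "interior_faces P \<Sigma> = {F \<in> \<Sigma>. \<not> F \<subseteq> rel_frontier P}"

definition poset_isomorphic ::
    "'a set \<Rightarrow> ('a \<Rightarrow> 'a \<Rightarrow> bool) \<Rightarrow> 'b set \<Rightarrow> ('b \<Rightarrow> 'b \<Rightarrow> bool) \<Rightarrow> bool" where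
  "poset_isomorphic X leX Y leY \<longleftrightarrow>
     (\<exists>f. bij_betw f X Y \<and> (\<forall>x\<in>X. \<forall>y\<in>X. leX x y \<longleftrightarrow> leY (f x) (f y)))"

text \<open>A matrix is a function \<open>V\<close>; only its entries \<open>V i j\<close> with \<open>i \<in> B\<close>, \<open>j \<notin> B\<close> matter.\<close>
definition augmented :: "'n set \<Rightarrow> ('n \<Rightarrow> 'n \<Rightarrow> ereal) \<Rightarrow> 'n \<Rightarrow> 'n \<Rightarrow> ereal" where
  "augmented B V i j = (if j \<in> B then (if i = j then 0 else \<infinity>) else V i j)"

definition tropical_minor :: "'n::finite set \<Rightarrow> ('n \<Rightarrow> 'n \<Rightarrow> ereal) \<Rightarrow> 'n set \<Rightarrow> ereal" where
  "tropical_minor B V A = (INF \<sigma>\<in>{\<sigma>. bij_betw \<sigma> A B}. \<Sum>a\<in>A. augmented B V (\<sigma> a) a)"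

definition transversal_bases :: "'n::finite set \<Rightarrow> ('n \<Rightarrow> 'n \<Rightarrow> ereal) \<Rightarrow> 'n set set" where
  "transversal_bases B V = {A. card A = card B \<and> tropical_minor B V A \<noteq> \<infinity>}"

definition vertex_figure_subdivision ::
    "'n::finite set set \<Rightarrow> 'n set \<Rightarrow> ('n \<Rightarrow> 'n \<Rightarrow> ereal) \<Rightarrow> (real ^ 'n) set set" where
  "vertex_figure_subdivision \<B> B V =
     regular_subdivision (exchange_pairs \<B> B) (exchange_vertex B)
       (\<lambda>(i, j). real_of_ereal (V i j))"

definition transversal_subdivision ::
    "'n::finite set \<Rightarrow> ('n \<Rightarrow> 'n \<Rightarrow> ereal) \<Rightarrow> (real ^ 'n) set set" where
  "transversal_subdivision B V =
     regular_subdivision (transversal_bases B V) indicator_vec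
       (\<lambda>A. real_of_ereal (tropical_minor B V A))"

end

theory Submission
  imports Defs
begin

text \<open>
  Let \<open>E\<close> be the bipartite graph of the pairs \<open>(i, j)\<close> with \<open>V i j\<close> finite.  The vertices of the
  vertex figure are indexed by the edges of \<open>E\<close>, and the bases \<open>A\<close> of the transversal matroid arise
  from \<open>B\<close> by exchange along matchings of \<open>E\<close>; the tropical minor of \<open>A\<close> is the least weight of a
  matching between \<open>B - A\<close> and \<open>A - B\<close>.  A linear functional \<open>u\<close> replaces the weights by the
  reduced costs \<open>V i j + u j - u i\<close>.  Hence \<open>u\<close> selects a set of edges of minimum reduced cost on
  the vertex figure, and the bases obtained from matchings of minimum reduced cost on the matroid
  polytope.

  Both posets are modelled by the sets \<open>G\<close> of tight edges, the edges of reduced cost \<open>0\<close> for some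
  \<open>u\<close> that makes all reduced costs nonnegative.  Since \<open>u\<close> may be shifted by a multiple of the
  indicator vector of \<open>B\<close>, every nonempty cell of the vertex figure comes from such a set.  On the
  matroid side, a cell through the vertex of \<open>B\<close> is one for which the empty matching is optimal;
  then no reduced cost is negative, and the optimal matchings are those made of tight edges.  Both
  kinds of cell determine \<open>G\<close> and grow with it.  They are also interior at the same time: nonempty
  proper faces of the vertex figure and proper faces of the polytope through the vertex of \<open>B\<close> are
  cut out by the functionals \<open>w\<close> with \<open>w j - w i \<ge> 0\<close> on all edges and \<open>> 0\<close> on some edge.

  The remaining point is that every interior cell of the matroid subdivision contains the vertex
  of \<open>B\<close> (lemma \<open>interior_cell_contains_B\<close>).  In an interior cell every ground set element is
  missed by some optimal matching, since otherwise the cell lies in a coordinate facet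
  of the cube that does not contain the vertex of \<open>B\<close>.  Superposing one such matching for each of
  the \<open>n\<close> elements gives a bipartite multigraph of maximum degree at most \<open>n - 1\<close>, which splits
  into \<open>n - 1\<close> matchings by Koenig's edge colouring theorem (lemma \<open>bipartite_edge_colouring\<close>).
  Comparing total costs shows that the optimum is not negative, so the empty matching attains it.
\<close>

section \<open>Cells of a regular subdivision\<close>

lemma exposed_face_convex_hull:
  fixes S :: "'a::euclidean_space set"
  assumes fin: "finite S" and le: "\<And>y. y \<in> S \<Longrightarrow> c \<le> a \<bullet> y"
  shows "{z \<in> convex hull S. a \<bullet> z = c} = convex hull {y \<in> S. a \<bullet> y = c}"
proof (intro equalityI subsetI)
  fix z assume "z \<in> {z \<in> convex hull S. a \<bullet> z = c}"
  then obtain s where s: "\<forall>x\<in>S. 0 \<le> s x" "sum s S = 1" "(\<Sum>x\<in>S. s x *\<^sub>R x) = z" and az: "a \<bullet> z = c"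
    using convex_hull_finite[OF fin] by auto
  have "(\<Sum>x\<in>S. s x * (a \<bullet> x - c)) = a \<bullet> z - sum s S * c"
    using s(3) by (auto simp: algebra_simps sum_subtractf inner_sum_right sum_distrib_left)
  also have "\<dots> = 0" using s az by simp
  finally have "\<forall>x\<in>S. s x * (a \<bullet> x - c) = 0"
    using sum_nonneg_eq_0_iff[OF fin, of "\<lambda>x. s x * (a \<bullet> x - c)"] s(1) le by simp
  then have off: "s x = 0" if "x \<in> S - {y \<in> S. a \<bullet> y = c}" for x using that by auto
  have "sum s {y \<in> S. a \<bullet> y = c} = 1"
    using s(2) off by (subst sum.mono_neutral_left[OF fin]) auto
  moreover have "(\<Sum>x\<in>{y \<in> S. a \<bullet> y = c}. s x *\<^sub>R x) = z"
    unfolding s(3)[symmetric] using off by (intro sum.mono_neutral_left[OF fin]) auto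
  ultimately show "z \<in> convex hull {y \<in> S. a \<bullet> y = c}"
    using s(1) fin by (subst convex_hull_finite) auto
next
  fix z assume z: "z \<in> convex hull {y \<in> S. a \<bullet> y = c}"
  have "convex hull {y \<in> S. a \<bullet> y = c} \<subseteq> convex hull S" by (rule hull_mono) auto
  moreover have "convex hull {y \<in> S. a \<bullet> y = c} \<subseteq> {y. a \<bullet> y = c}"
    by (rule hull_minimal) (auto simp: convex_hyperplane)
  ultimately show "z \<in> {z \<in> convex hull S. a \<bullet> z = c}" using z by auto
qed

lemma convex_hull_inner_ge:
  assumes "\<And>i. i \<in> I \<Longrightarrow> c \<le> a \<bullet> p i" "z \<in> convex hull (p ` I)"
  shows "c \<le> a \<bullet> z"
proof -
  have "convex hull (p ` I) \<subseteq> {y. a \<bullet> y \<ge> c}"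
    using assms(1) by (intro hull_minimal) (auto simp: convex_halfspace_ge)
  then show ?thesis using assms(2) by auto
qed

text \<open>
  The supporting functional of a lower face has last coordinate 1, so the cell below it is
  spanned by the points at which the tilted height \<open>u \<bullet> p i + h i\<close> attains its minimum.  The
  constant \<open>c\<close> may also lie strictly below that minimum, which gives the empty cell.
\<close>
lemma regular_subdivision_eq_convex_hulls:
  assumes fin: "finite I"
  shows "regular_subdivision I p h =
    {convex hull (p ` {i \<in> I. u \<bullet> p i + h i = c}) | u c. \<forall>i\<in>I. c \<le> u \<bullet> p i + h i}"
proof -
  let ?L = "\<lambda>i. (p i, h i)"
  have supp: "(\<forall>z\<in>convex hull (?L ` I). c \<le> (u, 1) \<bullet> z) \<longleftrightarrow> (\<forall>i\<in>I. c \<le> u \<bullet> p i + h i)" for u c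
  proof
    assume "\<forall>z\<in>convex hull (?L ` I). c \<le> (u, 1) \<bullet> z"
    moreover have "?L i \<in> convex hull (?L ` I)" if "i \<in> I" for i using that by (simp add: hull_inc)
    ultimately show "\<forall>i\<in>I. c \<le> u \<bullet> p i + h i" by fastforce
  next
    assume "\<forall>i\<in>I. c \<le> u \<bullet> p i + h i"
    then show "\<forall>z\<in>convex hull (?L ` I). c \<le> (u, 1) \<bullet> z"
      using convex_hull_inner_ge[where p = ?L and a = "(u, 1)"] by force
  qed
  have cell: "fst ` {z \<in> convex hull (?L ` I). (u, 1) \<bullet> z = c}
      = convex hull (p ` {i \<in> I. u \<bullet> p i + h i = c})"
    if "\<forall>i\<in>I. c \<le> u \<bullet> p i + h i" for u c
  proof -
    have "{z \<in> convex hull (?L ` I). (u, 1) \<bullet> z = c} = convex hull {y \<in> ?L ` I. (u, 1) \<bullet> y = c}"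
      using that fin by (intro exposed_face_convex_hull) auto
    moreover have "fst ` {y \<in> ?L ` I. (u, 1) \<bullet> y = c} = p ` {i \<in> I. u \<bullet> p i + h i = c}" by force
    ultimately show ?thesis by (simp add: convex_hull_linear_image linear_fst)
  qed
  have "regular_subdivision I p h =
      {fst ` {z \<in> convex hull (?L ` I). (u, 1) \<bullet> z = c} | u c. \<forall>i\<in>I. c \<le> u \<bullet> p i + h i}"
    unfolding regular_subdivision_def lower_faces_def supp by blast
  also have "\<dots> = {convex hull (p ` {i \<in> I. u \<bullet> p i + h i = c}) | u c. \<forall>i\<in>I. c \<le> u \<bullet> p i + h i}"
    using cell by (intro Collect_cong ex_cong1 rev_conj_cong refl) simp
  finally show ?thesis .
qed

text \<open>
  A convex subset of the relative boundary lies in one proper exposed face: a hyperplane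
  supporting the polytope at the barycentre of the points in \<open>K\<close> contains all of them.
\<close>
lemma convex_hull_subset_rel_frontier_iff:
  fixes p :: "'i \<Rightarrow> 'a::euclidean_space"
  assumes fin: "finite I" and K: "K \<subseteq> I" "K \<noteq> {}"
  shows "convex hull (p ` K) \<subseteq> rel_frontier (convex hull (p ` I)) \<longleftrightarrow>
    (\<exists>w c. (\<forall>i\<in>I. c \<le> w \<bullet> p i) \<and> (\<forall>i\<in>K. w \<bullet> p i = c) \<and> (\<exists>i\<in>I. w \<bullet> p i \<noteq> c))"
    (is "?F \<subseteq> rel_frontier ?P \<longleftrightarrow> _")
proof
  assume sub: "?F \<subseteq> rel_frontier ?P"
  have finK: "finite K" using fin K finite_subset by blast
  then have card: "card K > 0" using K by (simp add: card_gt_0_iff)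
  define x where "x = (\<Sum>k\<in>K. (1 / card K) *\<^sub>R p k)"
  have xF: "x \<in> ?F"
    unfolding x_def using card finK
    by (intro convex_sum) (auto simp: hull_inc)
  then have "x \<in> rel_frontier ?P" using sub by auto
  then have "x \<notin> rel_interior ?P" by (auto simp: rel_frontier_def)
  moreover have "x \<in> ?P" using xF K hull_mono[of "p ` K" "p ` I"] by auto
  ultimately obtain w where w: "\<And>y. y \<in> ?P \<Longrightarrow> w \<bullet> x \<le> w \<bullet> y"
      "\<And>y. y \<in> rel_interior ?P \<Longrightarrow> w \<bullet> x < w \<bullet> y"
    using supporting_hyperplane_rel_boundary[OF convex_convex_hull] by metis
  have pI: "w \<bullet> x \<le> w \<bullet> p i" if "i \<in> I" for i using that by (intro w(1)) (simp add: hull_inc)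
  have "(\<Sum>k\<in>K. w \<bullet> p k - w \<bullet> x) = 0"
  proof -
    have "w \<bullet> x = (\<Sum>k\<in>K. w \<bullet> p k) / card K"
      unfolding x_def by (simp add: inner_sum_right sum_divide_distrib)
    then show ?thesis using card by (simp add: sum_subtractf)
  qed
  then have onK: "\<forall>k\<in>K. w \<bullet> p k = w \<bullet> x"
    using sum_nonneg_eq_0_iff[OF finK, of "\<lambda>k. w \<bullet> p k - w \<bullet> x"] pI K by auto
  have "\<exists>i\<in>I. w \<bullet> p i \<noteq> w \<bullet> x"
  proof (rule ccontr)
    assume "\<not> ?thesis"
    then have flat: "?P \<subseteq> {y. w \<bullet> y = w \<bullet> x}"
      by (intro hull_minimal) (auto simp: convex_hyperplane)
    have "rel_interior ?P \<noteq> {}" using K by (subst rel_interior_eq_empty) auto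
    then obtain y where "y \<in> rel_interior ?P" by auto
    then show False using w(2) flat rel_interior_subset by fastforce
  qed
  then show "\<exists>w c. (\<forall>i\<in>I. c \<le> w \<bullet> p i) \<and> (\<forall>i\<in>K. w \<bullet> p i = c) \<and> (\<exists>i\<in>I. w \<bullet> p i \<noteq> c)"
    using pI onK by blast
next
  assume "\<exists>w c. (\<forall>i\<in>I. c \<le> w \<bullet> p i) \<and> (\<forall>i\<in>K. w \<bullet> p i = c) \<and> (\<exists>i\<in>I. w \<bullet> p i \<noteq> c)"
  then obtain w c i where w: "\<forall>i\<in>I. c \<le> w \<bullet> p i" "\<forall>i\<in>K. w \<bullet> p i = c" and i: "i \<in> I" "w \<bullet> p i \<noteq> c"
    by blast
  let ?T = "?P \<inter> {y. w \<bullet> y = c}"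
  have "?T face_of ?P"
    using convex_hull_inner_ge[of I c w p] w(1)
    by (intro face_of_Int_supporting_hyperplane_ge) auto
  moreover have "p i \<in> ?P" "p i \<notin> ?T" using i by (auto simp: hull_inc)
  then have "?T \<noteq> ?P" by blast
  ultimately have "?T \<subseteq> rel_frontier ?P" by (rule face_of_subset_rel_frontier)
  moreover have "?F \<subseteq> ?T"
    using w(2) K by (intro hull_minimal) (auto simp: hull_inc convex_Int convex_hyperplane)
  ultimately show "?F \<subseteq> rel_frontier ?P" by blast
qed

section \<open>Zero-one vectors\<close>

lemma inner_indicator_vec: "w \<bullet> indicator_vec S = (\<Sum>i\<in>S. w $ i)"
  by (simp add: indicator_vec_def inner_sum_right inner_axis)

lemma indicator_vec_nth: "indicator_vec S $ i = (if i \<in> S then 1 else 0)"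
proof -
  have "indicator_vec S $ i = axis i 1 \<bullet> indicator_vec S" by (simp add: inner_axis' )
  also have "\<dots> = (if i \<in> S then 1 else 0)"
    unfolding inner_indicator_vec by (auto simp: axis_def sum.delta)
  finally show ?thesis .
qed

text \<open>
  Every zero-one vector is a vertex of the cube: \<open>indicator_vec A\<close> is the unique cube vertex
  minimising the functional with entry \<open>-1\<close> on \<open>A\<close> and \<open>1\<close> off \<open>A\<close>.
\<close>
lemma indicator_vec_in_convex_hull_iff:
  "indicator_vec A \<in> convex hull (indicator_vec ` \<A>) \<longleftrightarrow> A \<in> \<A>"
proof
  assume A: "indicator_vec A \<in> convex hull (indicator_vec ` \<A>)"
  define w :: "real ^ 'a" where "w = (\<chi> i. if i \<in> A then -1 else 1)"
  have val: "w \<bullet> indicator_vec C = card (C - A) - real (card (C \<inter> A))" for C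
  proof -
    have "w \<bullet> indicator_vec C = (\<Sum>i\<in>C - A. w $ i) + (\<Sum>i\<in>C \<inter> A. w $ i)"
      unfolding inner_indicator_vec by (subst sum.Int_Diff[of C _ A]) auto
    also have "(\<Sum>i\<in>C - A. w $ i) = card (C - A)" by (simp add: w_def)
    also have "(\<Sum>i\<in>C \<inter> A. w $ i) = - real (card (C \<inter> A))" by (simp add: w_def)
    finally show ?thesis by simp
  qed
  have ge: "- real (card A) \<le> w \<bullet> indicator_vec C" for C
  proof -
    have "card (C \<inter> A) \<le> card A" by (simp add: card_mono)
    then show ?thesis unfolding val by linarith
  qed
  have eqD: "C = A" if "w \<bullet> indicator_vec C = - real (card A)" for C
  proof -
    have le: "card (C \<inter> A) \<le> card A" by (simp add: card_mono)
    with that have "card (C - A) = 0" "card (C \<inter> A) = card A" unfolding val by linarith+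
    then show ?thesis by (metis Diff_eq_empty_iff Int_absorb2 card_0_eq card_subset_eq finite inf_le2)
  qed
  have "indicator_vec A \<in> {z \<in> convex hull (indicator_vec ` \<A>). w \<bullet> z = - real (card A)}"
    using A by (simp add: val)
  also have "\<dots> = convex hull {y \<in> indicator_vec ` \<A>. w \<bullet> y = - real (card A)}"
    using ge by (intro exposed_face_convex_hull) auto
  finally have "{y \<in> indicator_vec ` \<A>. w \<bullet> y = - real (card A)} \<noteq> {}"
    by (metis convex_hull_empty empty_iff)
  then show "A \<in> \<A>" using eqD by auto
qed (simp add: hull_inc)

section \<open>Edge colourings of bipartite multigraphs\<close>

text \<open>
  The edges met by an alternating walk that starts at \<open>v\<close> with an edge of colour \<open>\<alpha>\<close>.  It passes
  left endpoints from colour \<open>\<alpha>\<close> to \<open>\<beta>\<close> and right endpoints from \<open>\<beta>\<close> to \<open>\<alpha>\<close>.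
\<close>
inductive_set kempe_chain ::
    "'x set \<Rightarrow> ('x \<Rightarrow> 'a) \<Rightarrow> ('x \<Rightarrow> 'b) \<Rightarrow> ('x \<Rightarrow> nat) \<Rightarrow> nat \<Rightarrow> nat \<Rightarrow> 'b \<Rightarrow> 'x set"
  for X l r f \<alpha> \<beta> v where
    start: "y \<in> X \<Longrightarrow> r y = v \<Longrightarrow> f y = \<alpha> \<Longrightarrow> y \<in> kempe_chain X l r f \<alpha> \<beta> v"
  | left: "y \<in> kempe_chain X l r f \<alpha> \<beta> v \<Longrightarrow> f y = \<alpha> \<Longrightarrow> z \<in> X \<Longrightarrow> l z = l y \<Longrightarrow> f z = \<beta>
      \<Longrightarrow> z \<in> kempe_chain X l r f \<alpha> \<beta> v"
  | right: "y \<in> kempe_chain X l r f \<alpha> \<beta> v \<Longrightarrow> f y = \<beta> \<Longrightarrow> z \<in> X \<Longrightarrow> r z = r y \<Longrightarrow> f z = \<alpha>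
      \<Longrightarrow> z \<in> kempe_chain X l r f \<alpha> \<beta> v"

text \<open>
  Koenig's edge colouring theorem.  To colour one more edge from \<open>a\<close> to \<open>b\<close>, let \<open>\<alpha>\<close> be a colour
  missing at \<open>a\<close> and \<open>\<beta>\<close> one missing at \<open>b\<close>.  The chain of \<open>\<alpha>\<close>- and \<open>\<beta>\<close>-edges starting at \<open>b\<close>
  enters left vertices only along \<open>\<alpha>\<close>-edges, so it avoids \<open>a\<close>; exchanging the two colours on it
  frees \<open>\<alpha>\<close> at \<open>b\<close> too.
\<close>
lemma bipartite_edge_colouring:
  fixes l :: "'x \<Rightarrow> 'a" and r :: "'x \<Rightarrow> 'b"
  assumes "finite X"
    and "\<And>a. card {x \<in> X. l x = a} \<le> d" and "\<And>b. card {x \<in> X. r x = b} \<le> d"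
  shows "\<exists>f. (\<forall>x\<in>X. f x < d) \<and>
    (\<forall>k. inj_on l {x \<in> X. f x = k} \<and> inj_on r {x \<in> X. f x = k})"
  using assms
proof (induction X)
  case empty
  then show ?case by auto
next
  case (insert x X)
  have degl: "card {y \<in> X. l y = a} \<le> d" for a
    using insert.prems(1)[of a] insert.hyps(1)
      card_mono[of "{y \<in> insert x X. l y = a}" "{y \<in> X. l y = a}"] by (auto intro: order_trans)
  have degr: "card {y \<in> X. r y = b} \<le> d" for b
    using insert.prems(2)[of b] insert.hyps(1)
      card_mono[of "{y \<in> insert x X. r y = b}" "{y \<in> X. r y = b}"] by (auto intro: order_trans)
  obtain f where f: "\<forall>y\<in>X. f y < d" 
    and inj: "\<And>k. inj_on l {y \<in> X. f y = k}" "\<And>k. inj_on r {y \<in> X. f y = k}"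
    using insert.IH[OF degl degr] by blast
  have fl: "y = z" if "y \<in> X" "z \<in> X" "f y = f z" "l y = l z" for y z
    using inj(1)[of "f y"] that by (auto dest: inj_onD)
  have fr: "y = z" if "y \<in> X" "z \<in> X" "f y = f z" "r y = r z" for y z
    using inj(2)[of "f y"] that by (auto dest: inj_onD)
  have free: "\<exists>\<gamma><d. \<forall>y\<in>X. g y \<longrightarrow> f y \<noteq> \<gamma>" if "card {y \<in> insert x X. g y} \<le> d" "g x" for g
  proof -
    have "{y \<in> insert x X. g y} = insert x {y \<in> X. g y}" using that(2) by auto
    then have "card {y \<in> X. g y} < d" using that(1) insert.hyps by simp
    then have "card (f ` {y \<in> X. g y}) < card {..<d}"
      using card_image_le[of "{y \<in> X. g y}" f] insert.hyps(1) by simp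
    then have "\<not> {..<d} \<subseteq> f ` {y \<in> X. g y}"
      using insert.hyps(1) by (metis (no_types, lifting) card_mono finite_imageI finite_subset
        mem_Collect_eq not_le subsetI)
    then show ?thesis by auto
  qed
  obtain \<alpha> where \<alpha>: "\<alpha> < d" "\<And>y. y \<in> X \<Longrightarrow> l y = l x \<Longrightarrow> f y \<noteq> \<alpha>"
    using free[of "\<lambda>y. l y = l x"] insert.prems(1) by blast
  obtain \<beta> where \<beta>: "\<beta> < d" "\<And>y. y \<in> X \<Longrightarrow> r y = r x \<Longrightarrow> f y \<noteq> \<beta>"
    using free[of "\<lambda>y. r y = r x"] insert.prems(2) by blast
  define R where "R = kempe_chain X l r f \<alpha> \<beta> (r x)"
  have R_col: "f y = \<alpha> \<or> f y = \<beta>" "y \<in> X" if "y \<in> R" for y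
    using that unfolding R_def by (cases; auto)+
  have R_alpha: "r y = r x \<or> (\<exists>z\<in>R. f z = \<beta> \<and> r z = r y)" if "y \<in> R" "f y = \<alpha>" for y
    using that \<beta>(2) unfolding R_def by cases (auto dest: kempe_chain.left)
  have R_beta: "\<exists>z\<in>R. f z = \<alpha> \<and> l z = l y" if "y \<in> R" "f y = \<beta>" for y
    using that \<beta>(2) unfolding R_def by cases (auto dest: kempe_chain.right)
  have R_left: "z \<in> R" if yz: "y \<in> R" "z \<in> X" "l z = l y" "f y \<in> {\<alpha>, \<beta>}" "f z \<in> {\<alpha>, \<beta>}" for y z
  proof (cases "f y = \<beta>")
    case True
    then obtain y' where y': "y' \<in> R" "f y' = \<alpha>" "l y' = l y" using R_beta yz(1) by blast
    show ?thesis
    proof (cases "f z = \<beta>")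
      case False
      then have "z = y'" using yz y' R_col(2)[OF y'(1)] by (intro fl) auto
      then show ?thesis using y' by simp
    next
      case same: True
      then have "z = y" using yz True R_col(2)[OF yz(1)] by (intro fl) auto
      then show ?thesis using yz(1) by simp
    qed
  next
    case False
    then have fy: "f y = \<alpha>" using yz(4) by blast
    show ?thesis
    proof (cases "f z = \<beta>")
      case True
      with yz fy show ?thesis unfolding R_def by (metis kempe_chain.left)
    next
      case False
      then have "f z = f y" using yz(5) fy by fastforce
      then have "z = y" using yz(2,3) R_col(2)[OF yz(1)] fl by blast
      then show ?thesis using yz(1) by simp
    qed
  qed
  have R_right: "z \<in> R" if yz: "y \<in> R" "z \<in> X" "r z = r y" "f y \<in> {\<alpha>, \<beta>}" "f z \<in> {\<alpha>, \<beta>}" for y z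
  proof (cases "f y = \<alpha>")
    case True
    show ?thesis
    proof (cases "f z = \<alpha>")
      case False
      then have "f z = \<beta>" using yz(5) by blast
      then have "r y \<noteq> r x" using \<beta>(2)[of z] yz by auto
      then obtain y' where y': "y' \<in> R" "f y' = \<beta>" "r y' = r y" using R_alpha[OF yz(1) True] by blast
      then have "z = y'" using yz \<open>f z = \<beta>\<close> R_col(2)[OF y'(1)] by (intro fr) auto
      then show ?thesis using y' by simp
    next
      case same: True
      then have "z = y" using yz True R_col(2)[OF yz(1)] by (intro fr) auto
      then show ?thesis using yz(1) by simp
    qed
  next
    case False
    then have fy: "f y = \<beta>" using yz(4) by blast
    show ?thesis
    proof (cases "f z = \<alpha>")
      case True
      with yz fy show ?thesis unfolding R_def by (metis kempe_chain.right)
    next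
      case False
      then have "f z = f y" using yz(5) fy by fastforce
      then have "z = y" using yz(2,3) R_col(2)[OF yz(1)] fr by blast
      then show ?thesis using yz(1) by simp
    qed
  qed
  define g where "g y = (if y = x then \<alpha> else if y \<in> R then (if f y = \<alpha> then \<beta> else \<alpha>) else f y)" for y
  have gX: "g y = (if y \<in> R then (if f y = \<alpha> then \<beta> else \<alpha>) else f y)" if "y \<in> X" for y
    using that insert.hyps(2) by (auto simp: g_def)
  have gx: "g x = \<alpha>" by (simp add: g_def)
  have gl: "y = z" if yz: "y \<in> X" "z \<in> X" "g y = g z" "l y = l z" for y z
  proof (cases "y \<in> R \<longleftrightarrow> z \<in> R")
    case True
    then have "f y = f z" using yz R_col(1)[of y] R_col(1)[of z] by (auto simp: gX split: if_splits)
    then show ?thesis using fl yz by blast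
  next
    case False
    have "f y \<in> {\<alpha>, \<beta>}" "f z \<in> {\<alpha>, \<beta>}"
      using False yz R_col(1)[of y] R_col(1)[of z] by (auto simp: gX split: if_splits)
    then show ?thesis using False R_left[of y z] R_left[of z y] yz by metis
  qed
  have gr: "y = z" if yz: "y \<in> X" "z \<in> X" "g y = g z" "r y = r z" for y z
  proof (cases "y \<in> R \<longleftrightarrow> z \<in> R")
    case True
    then have "f y = f z" using yz R_col(1)[of y] R_col(1)[of z] by (auto simp: gX split: if_splits)
    then show ?thesis using fr yz by blast
  next
    case False
    have "f y \<in> {\<alpha>, \<beta>}" "f z \<in> {\<alpha>, \<beta>}"
      using False yz R_col(1)[of y] R_col(1)[of z] by (auto simp: gX split: if_splits)
    then show ?thesis using False R_right[of y z] R_right[of z y] yz by metis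
  qed
  have left_free: "g y \<noteq> \<alpha>" if y: "y \<in> X" "l y = l x" for y
  proof
    assume "g y = \<alpha>"
    then have "y \<in> R" "f y = \<beta>" using \<alpha>(2)[OF y] R_col(1)[of y] y by (auto simp: gX split: if_splits)
    then obtain z where "z \<in> R" "f z = \<alpha>" "l z = l y" using R_beta by blast
    then show False using \<alpha>(2)[of z] R_col(2)[of z] y by simp
  qed
  have right_free: "g y \<noteq> \<alpha>" if y: "y \<in> X" "r y = r x" for y
  proof
    assume "g y = \<alpha>"
    then show False
      using \<beta>(2)[OF y] R_col(1)[of y] y kempe_chain.start[of y X r "r x" f \<alpha> l \<beta>]
      by (auto simp: gX R_def split: if_splits)
  qed
  have "\<forall>y\<in>insert x X. g y < d" using f \<alpha>(1) \<beta>(1) by (auto simp: g_def)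
  moreover have "inj_on l {y \<in> insert x X. g y = k}" for k
    using gl left_free gx by (intro inj_onI) (auto, metis+)
  moreover have "inj_on r {y \<in> insert x X. g y = k}" for k
    using gr right_free gx by (intro inj_onI) (auto, metis+)
  ultimately show ?case by blast
qed

section \<open>Matchings and tropical minors\<close>

definition matching :: "('n \<times> 'n) set \<Rightarrow> ('n \<times> 'n) set \<Rightarrow> bool" where
  "matching G M \<longleftrightarrow> M \<subseteq> G \<and> inj_on fst M \<and> inj_on snd M"

definition exchange :: "'n set \<Rightarrow> ('n \<times> 'n) set \<Rightarrow> 'n set" where
  "exchange B M = (B - fst ` M) \<union> snd ` M"

lemma matching_empty [simp]: "matching G {}"
  by (simp add: matching_def)

lemma matching_singleton [simp]: "matching G {e} \<longleftrightarrow> e \<in> G"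
  by (simp add: matching_def)

lemma matching_mono: "matching G M \<Longrightarrow> G \<subseteq> H \<Longrightarrow> matching H M"
  by (auto simp: matching_def)

lemma exchange_empty [simp]: "exchange B {} = B"
  by (simp add: exchange_def)

text \<open>
  For each of the \<open>N\<close> vertices take a matching of minimum cost that misses it.  In the multigraph
  union of these \<open>N\<close> matchings every vertex has degree at most \<open>N - 1\<close>, so by Koenig's theorem
  the union splits into \<open>N - 1\<close> matchings, and comparing total costs gives
  \<open>N * opt \<ge> (N - 1) * opt\<close>.
\<close>
lemma minimum_cost_nonneg_if_every_vertex_missed:
  fixes c :: "'n::finite \<times> 'n \<Rightarrow> real"
  assumes opt: "\<And>M. matching E M \<Longrightarrow> opt \<le> sum c M"
    and miss: "\<And>x. \<exists>M. matching E M \<and> sum c M = opt \<and> x \<notin> fst ` M \<union> snd ` M"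
  shows "0 \<le> opt"
proof -
  obtain M where M: "\<And>x. matching E (M x)" "\<And>x. sum c (M x) = opt"
      "\<And>x. x \<notin> fst ` M x \<union> snd ` M x"
    using miss by metis
  define X where "X = (SIGMA x:(UNIV::'n set). M x)"
  define d where "d = CARD('n) - 1"
  have deg: "card {p \<in> X. g (snd p) = a} \<le> d"
    if inj: "\<And>x. inj_on g (M x)" and out: "\<And>x. x \<notin> g ` M x" for g and a :: 'n
  proof -
    have "inj_on fst {p \<in> X. g (snd p) = a}"
      using inj by (auto simp: X_def inj_on_def)
    moreover have "fst ` {p \<in> X. g (snd p) = a} \<subseteq> - {a}"
    proof (intro image_subsetI)
      fix p assume "p \<in> {p \<in> X. g (snd p) = a}"
      then have "a \<in> g ` M (fst p)" by (auto simp: X_def)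
      then show "fst p \<in> - {a}" using out[of "fst p"] by auto
    qed
    ultimately have "card {p \<in> X. g (snd p) = a} \<le> card (- {a})"
      by (intro card_inj_on_le[of fst]) simp_all
    then show ?thesis by (simp add: d_def Compl_eq_Diff_UNIV card_Diff_singleton)
  qed
  have "\<exists>f. (\<forall>p\<in>X. f p < d) \<and> (\<forall>k. inj_on (\<lambda>p. fst (snd p)) {p \<in> X. f p = k} \<and>
      inj_on (\<lambda>p. snd (snd p)) {p \<in> X. f p = k})"
    using M(1,3) by (intro bipartite_edge_colouring deg) (auto simp: matching_def)
  then obtain f where f: "\<And>p. p \<in> X \<Longrightarrow> f p < d"
      and fl: "\<And>k. inj_on (\<lambda>p. fst (snd p)) {p \<in> X. f p = k}"
      and fr: "\<And>k. inj_on (\<lambda>p. snd (snd p)) {p \<in> X. f p = k}"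
    by blast
  have colour: "opt \<le> (\<Sum>p\<in>{p \<in> X. f p = k}. c (snd p))" for k
  proof -
    let ?C = "{p \<in> X. f p = k}"
    have inj: "inj_on snd ?C" using fl[of k] by (auto simp: inj_on_def)
    have "inj_on fst (snd ` ?C)" "inj_on snd (snd ` ?C)"
      using fl[of k] fr[of k] by (auto simp: inj_on_def) 
    moreover have "M x \<subseteq> E" for x using M(1) by (simp add: matching_def)
    then have "snd ` ?C \<subseteq> E" by (fastforce simp: X_def)
    ultimately have "opt \<le> sum c (snd ` ?C)" by (intro opt) (simp add: matching_def)
    also have "\<dots> = (\<Sum>p\<in>?C. c (snd p))" using inj by (simp add: sum.reindex)
    finally show ?thesis .
  qed
  have "real d * opt = (\<Sum>k<d. opt)" by simp
  also have "\<dots> \<le> (\<Sum>k<d. \<Sum>p\<in>{p \<in> X. f p = k}. c (snd p))" by (intro sum_mono colour)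
  also have "\<dots> = (\<Sum>p\<in>X. c (snd p))" using f by (intro sum.group) auto
  also have "\<dots> = (\<Sum>x\<in>UNIV. sum c (M x))"
    unfolding X_def by (subst sum.Sigma) (auto simp: split_def)
  also have "\<dots> = real CARD('n) * opt" by (simp add: M(2))
  also have "real CARD('n) = real d + 1" by (simp add: d_def of_nat_diff Suc_leI)
  finally show ?thesis by (simp add: algebra_simps)
qed

locale exchange_graph =
  fixes B :: "'n::finite set" and V :: "'n \<Rightarrow> 'n \<Rightarrow> ereal"
  assumes entry_not_MInfty: "\<And>i j. i \<in> B \<Longrightarrow> j \<notin> B \<Longrightarrow> V i j \<noteq> -\<infinity>"
begin

definition edges :: "('n \<times> 'n) set" where
  "edges = {(i, j). i \<in> B \<and> j \<notin> B \<and> V i j \<noteq> \<infinity>}"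

definition weight :: "'n \<times> 'n \<Rightarrow> real" where
  "weight = (\<lambda>(i, j). real_of_ereal (V i j))"

definition cost :: "real ^ 'n \<Rightarrow> 'n \<times> 'n \<Rightarrow> real" where
  "cost u e = weight e + (u $ snd e - u $ fst e)"

abbreviation minor :: "'n set \<Rightarrow> real" where
  "minor A \<equiv> real_of_ereal (tropical_minor B V A)"

lemma edgesD: "e \<in> edges \<Longrightarrow> fst e \<in> B" "e \<in> edges \<Longrightarrow> snd e \<notin> B"
  by (auto simp: edges_def)

lemma ereal_weight: "e \<in> edges \<Longrightarrow> ereal (weight e) = V (fst e) (snd e)"
  using entry_not_MInfty by (auto simp: edges_def weight_def ereal_real)

lemma exchange_diff:
  assumes "matching edges M"
  shows "B - exchange B M = fst ` M" "exchange B M - B = snd ` M"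
proof -
  have "fst ` M \<subseteq> B" "snd ` M \<inter> B = {}" using assms by (auto simp: matching_def edges_def)
  then show "B - exchange B M = fst ` M" "exchange B M - B = snd ` M"
    unfolding exchange_def by blast+
qed

text \<open>
  A basis at distance one from \<open>B\<close> comes from a single edge, so a cell through \<open>B\<close> remembers
  its tight edges.
\<close>
lemma exchange_eq_singleton_iff:
  assumes M: "matching edges M" and e: "e \<in> edges"
  shows "exchange B M = exchange B {e} \<longleftrightarrow> M = {e}"
proof
  assume "exchange B M = exchange B {e}"
  then have "fst ` M = fst ` {e}" "snd ` M = snd ` {e}"
    using exchange_diff[OF M] exchange_diff[of "{e}"] e by simp_all
  then have "x = e" if "x \<in> M" for x
    using that by (intro prod_eqI) blast+
  moreover have "M \<noteq> {}" using \<open>fst ` M = fst ` {e}\<close> by force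
  ultimately show "M = {e}" by blast
qed simp

lemma inner_exchange:
  assumes "matching edges M"
  shows "w \<bullet> indicator_vec (exchange B M)
    = w \<bullet> indicator_vec B + (\<Sum>e\<in>M. w $ snd e - w $ fst e)"
proof -
  have sub: "fst ` M \<subseteq> B" "snd ` M \<inter> B = {}" and inj: "inj_on fst M" "inj_on snd M"
    using assms by (auto simp: matching_def edges_def)
  have "w \<bullet> indicator_vec (exchange B M) = (\<Sum>i\<in>B - fst ` M. w $ i) + (\<Sum>i\<in>snd ` M. w $ i)"
    unfolding inner_indicator_vec exchange_def using sub by (intro sum.union_disjoint) auto
  also have "\<dots> = (\<Sum>i\<in>B. w $ i) - (\<Sum>i\<in>fst ` M. w $ i) + (\<Sum>i\<in>snd ` M. w $ i)"
    using sub by (simp add: sum_diff)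
  also have "\<dots> = (\<Sum>i\<in>B. w $ i) + (\<Sum>e\<in>M. w $ snd e - w $ fst e)"
    using inj by (simp add: sum.reindex sum_subtractf)
  finally show ?thesis by (simp add: inner_indicator_vec)
qed

lemma exchange_vertex_eq:
  assumes "e \<in> edges"
  shows "exchange_vertex B e = indicator_vec (exchange B {e})"
  using assms by (cases e) (auto simp: vec_eq_iff edges_def exchange_vertex_def exchange_def
      indicator_vec_nth axis_def)

lemma inner_exchange_vertex:
  assumes "e \<in> edges"
  shows "w \<bullet> exchange_vertex B e = w \<bullet> indicator_vec B + (w $ snd e - w $ fst e)"
  using inner_exchange[of "{e}" w] assms by (simp add: exchange_vertex_eq)

lemma tropical_minor_exchange_le:
  assumes M: "matching edges M"
  shows "tropical_minor B V (exchange B M) \<le> ereal (sum weight M)"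
proof -
  have sub: "fst ` M \<subseteq> B" "snd ` M \<inter> B = {}" and inj: "inj_on fst M" "inj_on snd M"
    and E: "M \<subseteq> edges"
    using M by (auto simp: matching_def edges_def)
  define \<sigma> where "\<sigma> a = (if a \<in> B then a else fst (inv_into M snd a))" for a
  have \<sigma>e: "\<sigma> (snd e) = fst e" if "e \<in> M" for e
    using that sub inj by (auto simp: \<sigma>_def)
  have "bij_betw \<sigma> (snd ` M) (fst ` M)"
  proof (rule bij_betwI')
    show "(\<sigma> x = \<sigma> y) = (x = y)" if xy: "x \<in> snd ` M" "y \<in> snd ` M" for x y
    proof -
      obtain e e' where e: "e \<in> M" "x = snd e" "e' \<in> M" "y = snd e'" using xy by blast
      then have "\<sigma> x = \<sigma> y \<longleftrightarrow> e = e'" using inj(1) by (simp add: \<sigma>e inj_on_eq_iff)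
      then show ?thesis using inj(2) e by (simp add: inj_on_eq_iff)
    qed
    show "\<sigma> x \<in> fst ` M" if "x \<in> snd ` M" for x using that \<sigma>e by auto
    show "\<exists>x\<in>snd ` M. y = \<sigma> x" if "y \<in> fst ` M" for y using that \<sigma>e by force
  qed
  moreover have "bij_betw \<sigma> (B - fst ` M) (B - fst ` M)"
    by (auto simp: \<sigma>_def bij_betw_def inj_on_def)
  ultimately have "bij_betw \<sigma> ((B - fst ` M) \<union> snd ` M) ((B - fst ` M) \<union> fst ` M)"
    by (intro bij_betw_combine) auto
  then have bij: "bij_betw \<sigma> (exchange B M) B"
    using sub by (simp add: exchange_def Un_absorb2)
  have "(\<Sum>a\<in>exchange B M. augmented B V (\<sigma> a) a)
      = (\<Sum>a\<in>B - fst ` M. augmented B V (\<sigma> a) a) + (\<Sum>a\<in>snd ` M. augmented B V (\<sigma> a) a)"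
    unfolding exchange_def using sub by (intro sum.union_disjoint) auto
  also have "(\<Sum>a\<in>B - fst ` M. augmented B V (\<sigma> a) a) = 0"
    by (intro sum.neutral) (auto simp: augmented_def \<sigma>_def)
  also have "(\<Sum>a\<in>snd ` M. augmented B V (\<sigma> a) a) = (\<Sum>e\<in>M. augmented B V (\<sigma> (snd e)) (snd e))"
    using inj by (simp add: sum.reindex)
  also have "\<dots> = (\<Sum>e\<in>M. ereal (weight e))"
    using E \<sigma>e edgesD by (intro sum.cong) (auto simp: ereal_weight augmented_def)
  finally have "(\<Sum>a\<in>exchange B M. augmented B V (\<sigma> a) a) = ereal (sum weight M)" by simp
  then show ?thesis
    unfolding tropical_minor_def using bij by (metis (mono_tags, lifting) INF_lower mem_Collect_eq)
qed

text \<open>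
  The columns in \<open>B\<close> form the tropical identity, so a bijection of finite weight fixes
  \<open>A \<inter> B\<close> and matches \<open>A - B\<close> with \<open>B - A\<close> along edges.
\<close>
lemma tropical_minor_attained:
  assumes fin: "tropical_minor B V A \<noteq> \<infinity>"
  obtains M where "matching edges M" "exchange B M = A" "tropical_minor B V A = ereal (sum weight M)"
proof -
  let ?S = "{\<sigma>. bij_betw \<sigma> A B}"
  let ?f = "\<lambda>\<sigma>. \<Sum>a\<in>A. augmented B V (\<sigma> a) a"
  have "?S \<noteq> {}"
  proof
    assume "?S = {}"
    then have "tropical_minor B V A = \<infinity>" unfolding tropical_minor_def by (simp only: image_empty Inf_empty top_ereal_def)
    then show False using fin by simp
  qed
  then have "Inf (?f ` ?S) \<in> ?f ` ?S"
    by (subst cInf_eq_Min) (auto intro: Min_in)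
  then obtain \<sigma> where bij: "bij_betw \<sigma> A B" and val: "tropical_minor B V A = ?f \<sigma>"
    unfolding tropical_minor_def by auto
  have entry: "augmented B V (\<sigma> a) a \<noteq> \<infinity>" if "a \<in> A" for a
    using fin that unfolding val sum_Pinfty by simp
  have \<sigma>B: "\<sigma> a \<in> B" if "a \<in> A" for a using bij that by (auto simp: bij_betw_def)
  have fixed: "\<sigma> a = a" if "a \<in> A \<inter> B" for a
    using entry[of a] that by (auto simp: augmented_def split: if_splits)
  define M where "M = (\<lambda>a. (\<sigma> a, a)) ` (A - B)"
  have inj: "inj_on \<sigma> A" and img: "\<sigma> ` A = B" using bij by (auto simp: bij_betw_def)
  have "(\<sigma> a, a) \<in> edges" if "a \<in> A - B" for a
    using entry[of a] \<sigma>B[of a] that by (auto simp: augmented_def edges_def)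
  then have "M \<subseteq> edges" by (auto simp: M_def)
  then have M: "matching edges M"
    using inj by (auto simp: matching_def M_def inj_on_def)
  have fstM: "fst ` M = \<sigma> ` (A - B)" and sndM: "snd ` M = A - B" by (auto simp: M_def image_image)
  have "\<sigma> ` (A - B) = \<sigma> ` A - \<sigma> ` (A \<inter> B)"
    using inj by (metis Diff_Int Diff_cancel Un_empty_left inf_le1 inj_on_image_set_diff Diff_subset Diff_Diff_Int)
  also have "\<sigma> ` (A \<inter> B) = A \<inter> B" using fixed by force
  finally have "fst ` M = B - A" using img fstM by auto
  then have ex: "exchange B M = A" using sndM by (auto simp: exchange_def)
  have "?f \<sigma> = (\<Sum>a\<in>A \<inter> B. augmented B V (\<sigma> a) a) + (\<Sum>a\<in>A - B. augmented B V (\<sigma> a) a)"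
    by (subst sum.Int_Diff[of A _ B]) auto
  also have "(\<Sum>a\<in>A \<inter> B. augmented B V (\<sigma> a) a) = 0"
    using fixed by (intro sum.neutral) (auto simp: augmented_def)
  also have "(\<Sum>a\<in>A - B. augmented B V (\<sigma> a) a) = (\<Sum>e\<in>M. V (fst e) (snd e))"
    unfolding M_def by (subst sum.reindex) (auto simp: inj_on_def augmented_def)
  also have "\<dots> = (\<Sum>e\<in>M. ereal (weight e))"
    using \<open>M \<subseteq> edges\<close> by (intro sum.cong) (auto simp: ereal_weight)
  finally have "tropical_minor B V A = ereal (sum weight M)" unfolding val by simp
  then show ?thesis using that M ex by blast
qed

lemma minor_exchange_le:
  assumes "matching edges M"
  shows "minor (exchange B M) \<le> sum weight M"
proof -
  have le: "tropical_minor B V (exchange B M) \<le> ereal (sum weight M)"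
    using assms by (rule tropical_minor_exchange_le)
  then have "tropical_minor B V (exchange B M) \<noteq> \<infinity>" by auto
  then obtain r where "tropical_minor B V (exchange B M) = ereal r"
    by (metis tropical_minor_attained)
  with le show ?thesis by simp
qed

lemma transversal_bases_eq: "transversal_bases B V = exchange B ` {M. matching edges M}"
proof (intro equalityI subsetI)
  fix A assume "A \<in> transversal_bases B V"
  then show "A \<in> exchange B ` {M. matching edges M}"
    using tropical_minor_attained[of A] unfolding transversal_bases_def by force
next
  fix A assume "A \<in> exchange B ` {M. matching edges M}"
  then obtain M where M: "matching edges M" and A: "A = exchange B M" by auto
  have "card A = card (B - fst ` M) + card (snd ` M)"
    unfolding A exchange_def using M by (intro card_Un_disjoint) (auto simp: matching_def edges_def)
  also have "card (snd ` M) = card (fst ` M)" using M by (simp add: matching_def card_image)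
  also have "card (B - fst ` M) + card (fst ` M) = card B"
  proof -
    have "fst ` M \<subseteq> B" using M by (auto simp: matching_def edges_def)
    then show ?thesis by (metis add.commute card_Diff_subset card_mono finite le_add_diff_inverse)
  qed
  finally have "card A = card B" .
  moreover have "tropical_minor B V A \<noteq> \<infinity>"
    using tropical_minor_exchange_le[OF M] by (auto simp: A)
  ultimately show "A \<in> transversal_bases B V" by (simp add: transversal_bases_def)
qed

text \<open>
  Tilting the heights by \<open>u\<close> changes the height of a basis only through the reduced costs of
  the matching that produces it; the constant \<open>u \<bullet> indicator_vec B\<close> is common to all bases.
\<close>
lemma tilted_height_exchange_le:
  assumes "matching edges M"
  shows "u \<bullet> indicator_vec (exchange B M) + minor (exchange B M) \<le> u \<bullet> indicator_vec B + sum (cost u) M"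
  using minor_exchange_le[OF assms] by (simp add: inner_exchange[OF assms] cost_def sum.distrib)

lemma tilted_height_attained:
  assumes "A \<in> transversal_bases B V"
  obtains M where "matching edges M" "exchange B M = A"
    "u \<bullet> indicator_vec A + minor A = u \<bullet> indicator_vec B + sum (cost u) M"
proof -
  obtain M where M: "matching edges M" "exchange B M = A" "tropical_minor B V A = ereal (sum weight M)"
    using tropical_minor_attained[of A] assms by (auto simp: transversal_bases_def)
  then show ?thesis
    using that[of M] inner_exchange[of M u] by (simp add: cost_def sum.distrib)
qed

section \<open>Cells through the vertex of a basis\<close>

definition figure_cell :: "('n \<times> 'n) set \<Rightarrow> (real ^ 'n) set" where
  "figure_cell G = convex hull (exchange_vertex B ` G)"

definition basis_cell :: "('n \<times> 'n) set \<Rightarrow> (real ^ 'n) set" where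
  "basis_cell G = convex hull (indicator_vec ` exchange B ` {M. matching G M})"

text \<open>
  In terms of linear programming, \<open>u\<close> is a dual solution and \<open>G\<close> the set of edges that
  complementary slackness admits in an optimal matching.  The set \<open>G\<close> may be empty; it then
  gives the empty cell of the vertex figure and the vertex of \<open>B\<close> in the matroid polytope.
\<close>
definition tight :: "('n \<times> 'n) set \<Rightarrow> bool" where
  "tight G \<longleftrightarrow> (\<exists>u. (\<forall>e\<in>edges. 0 \<le> cost u e) \<and> G = {e \<in> edges. cost u e = 0})"

text \<open>
  A functional \<open>w\<close> of this kind cuts out a proper face of the matroid polytope through the vertex
  of \<open>B\<close>, because the edge directions \<open>e\<^sub>j - e\<^sub>i\<close> generate the cone of the polytope at that
  vertex; after a shift by a multiple of \<open>indicator_vec B\<close>, every functional that cuts out a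
  nonempty proper face of the vertex figure has this form too.  So one criterion decides
  interiority on both sides.
\<close>
definition on_boundary :: "('n \<times> 'n) set \<Rightarrow> bool" where
  "on_boundary G \<longleftrightarrow> (\<exists>w :: real ^ 'n. (\<forall>e\<in>edges. w $ fst e \<le> w $ snd e) \<and>
     (\<forall>e\<in>G. w $ snd e = w $ fst e) \<and> (\<exists>e\<in>edges. w $ snd e \<noteq> w $ fst e))"

lemma tight_subset: "tight G \<Longrightarrow> G \<subseteq> edges"
  by (auto simp: tight_def)

lemma on_boundary_empty:
  assumes "edges \<noteq> {}"
  shows "on_boundary {}"
proof -
  obtain e where "e \<in> edges" using assms by blast
  then have "\<exists>e\<in>edges. indicator_vec (- B) $ snd e \<noteq> (indicator_vec (- B) :: real ^ 'n) $ fst e"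
    by (intro bexI[of _ e]) (auto simp: indicator_vec_nth dest: edgesD)
  moreover have "\<forall>e\<in>edges. indicator_vec (- B) $ fst e \<le> (indicator_vec (- B) :: real ^ 'n) $ snd e"
    by (auto simp: indicator_vec_nth dest: edgesD)
  ultimately show ?thesis unfolding on_boundary_def by blast
qed

lemma figure_cell_subset_iff:
  assumes "G \<subseteq> edges" "H \<subseteq> edges"
  shows "figure_cell G \<subseteq> figure_cell H \<longleftrightarrow> G \<subseteq> H"
proof
  assume sub: "figure_cell G \<subseteq> figure_cell H"
  show "G \<subseteq> H"
  proof
    fix e assume e: "e \<in> G"
    then have "exchange_vertex B e \<in> figure_cell G" by (simp add: figure_cell_def hull_inc)
    then have "indicator_vec (exchange B {e}) \<in> figure_cell H"
      using e sub assms exchange_vertex_eq[of e] by (metis subsetD)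
    also have "figure_cell H = convex hull (indicator_vec ` (\<lambda>e. exchange B {e}) ` H)"
      unfolding figure_cell_def image_image using assms exchange_vertex_eq
      by (intro arg_cong[where f = "\<lambda>S. convex hull S"] image_cong) auto
    finally obtain e' where "e' \<in> H" "exchange B {e} = exchange B {e'}"
      unfolding indicator_vec_in_convex_hull_iff by blast
    then show "e \<in> H"
      using exchange_eq_singleton_iff[of "{e}" e'] assms e by auto
  qed
qed (auto simp: figure_cell_def intro!: hull_mono)

lemma basis_cell_subset_iff:
  assumes "G \<subseteq> edges" "H \<subseteq> edges"
  shows "basis_cell G \<subseteq> basis_cell H \<longleftrightarrow> G \<subseteq> H"
proof
  assume sub: "basis_cell G \<subseteq> basis_cell H"
  show "G \<subseteq> H"
  proof
    fix e assume e: "e \<in> G"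
    have "indicator_vec (exchange B {e}) \<in> basis_cell G"
      unfolding basis_cell_def using e by (intro hull_inc imageI) auto
    then have "indicator_vec (exchange B {e}) \<in> basis_cell H" using sub by blast
    then obtain M where M: "matching H M" "exchange B M = exchange B {e}"
      unfolding basis_cell_def indicator_vec_in_convex_hull_iff by auto
    then have "M = {e}"
      using exchange_eq_singleton_iff[of M e] matching_mono[of H M edges] assms e by blast
    then show "e \<in> H" using M by simp
  qed
next
  assume "G \<subseteq> H"
  then show "basis_cell G \<subseteq> basis_cell H"
    unfolding basis_cell_def by (intro hull_mono image_mono Collect_mono) (auto dest: matching_mono)
qed

text \<open>
  Adding a multiple of \<open>indicator_vec B\<close> to a functional shifts all its edge differences by the
  same amount.  So a minimum over \<open>edges\<close> can be normalised to \<open>0\<close>, the value at \<open>B\<close>.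
\<close>
lemma shift_diff:
  assumes "e \<in> edges"
  shows "(u + t *\<^sub>R indicator_vec B) $ snd e - (u + t *\<^sub>R indicator_vec B) $ fst e
    = u $ snd e - u $ fst e - t"
  using edgesD[OF assms] by (simp add: indicator_vec_nth)

lemma figure_cell_subset_rel_frontier_iff:
  assumes G: "G \<subseteq> edges" "G \<noteq> {}"
  shows "figure_cell G \<subseteq> rel_frontier (convex hull (exchange_vertex B ` edges)) \<longleftrightarrow> on_boundary G"
proof -
  have "figure_cell G \<subseteq> rel_frontier (convex hull (exchange_vertex B ` edges)) \<longleftrightarrow>
    (\<exists>w c. (\<forall>e\<in>edges. c \<le> w \<bullet> exchange_vertex B e) \<and> (\<forall>e\<in>G. w \<bullet> exchange_vertex B e = c) \<and>
      (\<exists>e\<in>edges. w \<bullet> exchange_vertex B e \<noteq> c))"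
    unfolding figure_cell_def using G by (intro convex_hull_subset_rel_frontier_iff) auto
  also have "\<dots> \<longleftrightarrow> on_boundary G"
  proof
    assume "\<exists>w c. (\<forall>e\<in>edges. c \<le> w \<bullet> exchange_vertex B e) \<and> (\<forall>e\<in>G. w \<bullet> exchange_vertex B e = c) \<and>
      (\<exists>e\<in>edges. w \<bullet> exchange_vertex B e \<noteq> c)"
    then obtain w c where w: "\<forall>e\<in>edges. c \<le> w \<bullet> exchange_vertex B e"
      "\<forall>e\<in>G. w \<bullet> exchange_vertex B e = c" "\<exists>e\<in>edges. w \<bullet> exchange_vertex B e \<noteq> c" by blast
    define w' where "w' = w + (c - w \<bullet> indicator_vec B) *\<^sub>R indicator_vec B"
    have "w' $ snd e - w' $ fst e = w \<bullet> exchange_vertex B e - c" if "e \<in> edges" for e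
      unfolding w'_def shift_diff[OF that] inner_exchange_vertex[OF that] by simp
    then have "\<forall>e\<in>edges. w' $ fst e \<le> w' $ snd e" "\<forall>e\<in>G. w' $ snd e = w' $ fst e"
      "\<exists>e\<in>edges. w' $ snd e \<noteq> w' $ fst e"
      using w G by (smt (verit) subsetD)+
    then show "on_boundary G" unfolding on_boundary_def by blast
  next
    assume "on_boundary G"
    then obtain w :: "real ^ 'n" where w: "\<forall>e\<in>edges. w $ fst e \<le> w $ snd e"
      "\<forall>e\<in>G. w $ snd e = w $ fst e" "\<exists>e\<in>edges. w $ snd e \<noteq> w $ fst e"
      unfolding on_boundary_def by blast
    show "\<exists>w c. (\<forall>e\<in>edges. c \<le> w \<bullet> exchange_vertex B e) \<and> (\<forall>e\<in>G. w \<bullet> exchange_vertex B e = c) \<and>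
      (\<exists>e\<in>edges. w \<bullet> exchange_vertex B e \<noteq> c)"
      using w G by (intro exI[of _ w] exI[of _ "w \<bullet> indicator_vec B"]) (auto simp: inner_exchange_vertex subset_iff)
  qed
  finally show ?thesis .
qed

lemma basis_cell_subset_rel_frontier_iff:
  assumes G: "G \<subseteq> edges"
  shows "basis_cell G \<subseteq> rel_frontier (convex hull (indicator_vec ` transversal_bases B V)) \<longleftrightarrow> on_boundary G"
proof -
  let ?K = "exchange B ` {M. matching G M}"
  have K: "?K \<subseteq> transversal_bases B V"
    unfolding transversal_bases_eq using G by (auto intro: matching_mono)
  have BK: "B \<in> ?K" by (intro image_eqI[of _ _ "{}"]) auto
  have "basis_cell G \<subseteq> rel_frontier (convex hull (indicator_vec ` transversal_bases B V)) \<longleftrightarrow>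
    (\<exists>w c. (\<forall>A\<in>transversal_bases B V. c \<le> w \<bullet> indicator_vec A) \<and> (\<forall>A\<in>?K. w \<bullet> indicator_vec A = c) \<and>
      (\<exists>A\<in>transversal_bases B V. w \<bullet> indicator_vec A \<noteq> c))"
    unfolding basis_cell_def using K BK by (intro convex_hull_subset_rel_frontier_iff) auto
  also have "\<dots> \<longleftrightarrow> on_boundary G"
  proof
    assume "\<exists>w c. (\<forall>A\<in>transversal_bases B V. c \<le> w \<bullet> indicator_vec A) \<and>
      (\<forall>A\<in>?K. w \<bullet> indicator_vec A = c) \<and> (\<exists>A\<in>transversal_bases B V. w \<bullet> indicator_vec A \<noteq> c)"
    then obtain w A where w: "\<forall>A\<in>transversal_bases B V. w \<bullet> indicator_vec B \<le> w \<bullet> indicator_vec A"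
      "\<forall>A\<in>?K. w \<bullet> indicator_vec A = w \<bullet> indicator_vec B"
      and A: "A \<in> transversal_bases B V" "w \<bullet> indicator_vec A \<noteq> w \<bullet> indicator_vec B"
      using BK by metis
    have edge: "w \<bullet> indicator_vec (exchange B {e}) = w \<bullet> indicator_vec B + (w $ snd e - w $ fst e)"
      if "e \<in> edges" for e using inner_exchange[of "{e}" w] that by simp
    have "w $ fst e \<le> w $ snd e" if "e \<in> edges" for e
    proof -
      have "exchange B {e} \<in> transversal_bases B V" unfolding transversal_bases_eq using that by simp
      then show ?thesis using w(1) edge[OF that] by fastforce
    qed
    moreover have "w $ snd e = w $ fst e" if "e \<in> G" for e
    proof -
      have "exchange B {e} \<in> ?K" using that by simp
      then show ?thesis using w(2) edge[of e] that G by fastforce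
    qed
    moreover have "\<exists>e\<in>edges. w $ snd e \<noteq> w $ fst e"
    proof (rule ccontr)
      assume flat: "\<not> ?thesis"
      obtain M where M: "matching edges M" "A = exchange B M"
        using A(1) unfolding transversal_bases_eq by auto
      then have "(\<Sum>e\<in>M. w $ snd e - w $ fst e) = 0"
        using flat by (intro sum.neutral) (auto simp: matching_def)
      then show False using A(2) M inner_exchange[of M w] by simp
    qed
    ultimately show "on_boundary G" unfolding on_boundary_def by blast
  next
    assume "on_boundary G"
    then obtain w :: "real ^ 'n" and e
      where w: "\<forall>e\<in>edges. w $ fst e \<le> w $ snd e" "\<forall>e\<in>G. w $ snd e = w $ fst e"
      and e: "e \<in> edges" "w $ snd e \<noteq> w $ fst e"
      unfolding on_boundary_def by blast
    have ge: "w \<bullet> indicator_vec B \<le> w \<bullet> indicator_vec A" if A: "A \<in> transversal_bases B V" for A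
    proof -
      obtain M where M: "matching edges M" "A = exchange B M"
        using A unfolding transversal_bases_eq by auto
      then have "0 \<le> (\<Sum>e\<in>M. w $ snd e - w $ fst e)"
        using w(1) by (intro sum_nonneg) (auto simp: matching_def)
      then show ?thesis using M inner_exchange[of M w] by simp
    qed
    have on: "w \<bullet> indicator_vec A = w \<bullet> indicator_vec B" if A: "A \<in> ?K" for A
    proof -
      obtain M where M: "matching G M" "A = exchange B M" using A by auto
      then have "(\<Sum>e\<in>M. w $ snd e - w $ fst e) = 0"
        using w(2) by (intro sum.neutral) (auto simp: matching_def)
      then show ?thesis using M inner_exchange[of M w] matching_mono[OF M(1) G] by simp
    qed
    have eT: "exchange B {e} \<in> transversal_bases B V" unfolding transversal_bases_eq using e by simp
    have off: "w \<bullet> indicator_vec (exchange B {e}) \<noteq> w \<bullet> indicator_vec B"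
      using inner_exchange[of "{e}" w] e by simp
    show "\<exists>w c. (\<forall>A\<in>transversal_bases B V. c \<le> w \<bullet> indicator_vec A) \<and>
      (\<forall>A\<in>?K. w \<bullet> indicator_vec A = c) \<and> (\<exists>A\<in>transversal_bases B V. w \<bullet> indicator_vec A \<noteq> c)"
      using ge on eT off
      by (intro exI[of _ w] exI[of _ "w \<bullet> indicator_vec B"] conjI ballI bexI[of _ "exchange B {e}"])
  qed
  finally show ?thesis .
qed

section \<open>Interior cells\<close>

lemma interior_figure_cells:
  assumes ne: "edges \<noteq> {}"
  shows "interior_faces (convex hull (exchange_vertex B ` edges))
      (regular_subdivision edges (exchange_vertex B) weight)
    = figure_cell ` {G. tight G \<and> \<not> on_boundary G}" (is "interior_faces ?P ?S = _")
proof (intro equalityI subsetI)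
  fix F assume "F \<in> interior_faces ?P ?S"
  then obtain u c where le: "\<forall>e\<in>edges. c \<le> u \<bullet> exchange_vertex B e + weight e"
    and F: "F = figure_cell {e \<in> edges. u \<bullet> exchange_vertex B e + weight e = c}"
    and int: "\<not> F \<subseteq> rel_frontier ?P"
    by (auto simp: interior_faces_def regular_subdivision_eq_convex_hulls figure_cell_def)
  \<comment> \<open>The minimum \<open>c\<close> on the vertex figure differs in general from the value at \<open>B\<close>.\<close>
  define u' where "u' = u + (c - u \<bullet> indicator_vec B) *\<^sub>R indicator_vec B"
  have cost: "cost u' e = u \<bullet> exchange_vertex B e + weight e - c" if "e \<in> edges" for e
    unfolding cost_def u'_def shift_diff[OF that] inner_exchange_vertex[OF that] by simp
  let ?G = "{e \<in> edges. u \<bullet> exchange_vertex B e + weight e = c}"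
  have "?G = {e \<in> edges. cost u' e = 0}" using cost by auto
  then have "tight ?G" unfolding tight_def using cost le by (intro exI[of _ u']) auto
  moreover have "?G \<noteq> {}"
    using int F by (metis convex_hull_empty empty_subsetI figure_cell_def image_empty)
  then have "\<not> on_boundary ?G" using figure_cell_subset_rel_frontier_iff[of ?G] int F by blast
  ultimately show "F \<in> figure_cell ` {G. tight G \<and> \<not> on_boundary G}" using F by blast
next
  fix F assume "F \<in> figure_cell ` {G. tight G \<and> \<not> on_boundary G}"
  then obtain G where G: "tight G" "\<not> on_boundary G" and F: "F = figure_cell G" by blast
  then obtain u where u: "\<forall>e\<in>edges. 0 \<le> cost u e" "G = {e \<in> edges. cost u e = 0}"
    unfolding tight_def by blast
  have height: "u \<bullet> exchange_vertex B e + weight e = u \<bullet> indicator_vec B + cost u e"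
    if "e \<in> edges" for e using that by (simp add: inner_exchange_vertex cost_def)
  have "G = {e \<in> edges. u \<bullet> exchange_vertex B e + weight e = u \<bullet> indicator_vec B}"
    using u(2) height by auto
  moreover have "\<forall>e\<in>edges. u \<bullet> indicator_vec B \<le> u \<bullet> exchange_vertex B e + weight e"
    using u(1) height by auto
  ultimately have "F \<in> ?S"
    unfolding regular_subdivision_eq_convex_hulls[OF finite] F figure_cell_def by blast
  moreover have "G \<noteq> {}" using G(2) on_boundary_empty[OF ne] by blast
  then have "\<not> F \<subseteq> rel_frontier ?P"
    unfolding F using G figure_cell_subset_rel_frontier_iff tight_subset by blast
  ultimately show "F \<in> interior_faces ?P ?S" by (simp add: interior_faces_def)
qed

text \<open>
  If an element \<open>i\<close> of \<open>B\<close> is absent from all bases of the cell, or an element \<open>j\<close> outside \<open>B\<close> is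
  present in all of them, then the cell lies in the face \<open>x\<^sub>i = 0\<close> or \<open>x\<^sub>j = 1\<close>, which does not
  contain the vertex of \<open>B\<close>.  So for an interior cell every element is missed by an optimal
  matching, and the empty matching is optimal.
\<close>
lemma interior_cell_contains_B:
  assumes le: "\<forall>A\<in>transversal_bases B V. c \<le> u \<bullet> indicator_vec A + minor A"
    and K: "K = {A \<in> transversal_bases B V. u \<bullet> indicator_vec A + minor A = c}"
    and int: "\<not> convex hull (indicator_vec ` K) \<subseteq> rel_frontier (convex hull (indicator_vec ` transversal_bases B V))"
  shows "c = u \<bullet> indicator_vec B"
proof -
  let ?\<T> = "transversal_bases B V"
  have BT: "B \<in> ?\<T>" unfolding transversal_bases_eq by (intro image_eqI[of _ _ "{}"]) auto
  have Kne: "K \<noteq> {}" using int by auto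
  have no_face: "\<exists>A\<in>K. w \<bullet> indicator_vec A \<noteq> b"
    if "\<And>A. b \<le> w \<bullet> indicator_vec A" "w \<bullet> indicator_vec B \<noteq> b" for w :: "real ^ 'n" and b
  proof (rule ccontr)
    assume "\<not> ?thesis"
    then have "\<exists>w c. (\<forall>A\<in>?\<T>. c \<le> w \<bullet> indicator_vec A) \<and> (\<forall>A\<in>K. w \<bullet> indicator_vec A = c) \<and>
        (\<exists>A\<in>?\<T>. w \<bullet> indicator_vec A \<noteq> c)"
      using that BT by (intro exI[of _ w] exI[of _ b]) auto
    then show False
      using int Kne K by (subst (asm) convex_hull_subset_rel_frontier_iff) auto
  qed
  have missed: "\<exists>A\<in>K. x \<notin> (B - A) \<union> (A - B)" for x
  proof (cases "x \<in> B")
    case True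
    have coord: "axis x 1 \<bullet> indicator_vec A = (if x \<in> A then 1 else (0::real))" for A
      by (simp add: inner_axis' indicator_vec_nth)
    have "\<exists>A\<in>K. axis x 1 \<bullet> indicator_vec A \<noteq> (0::real)"
      by (rule no_face) (simp_all only: coord True, simp_all)
    then show ?thesis using True by (auto simp: coord split: if_splits)
  next
    case False
    have coord: "- axis x 1 \<bullet> indicator_vec A = (if x \<in> A then -1 else (0::real))" for A
      by (simp add: inner_axis' indicator_vec_nth)
    have "\<exists>A\<in>K. - axis x 1 \<bullet> indicator_vec A \<noteq> (-1::real)"
      by (rule no_face) (simp_all only: coord False, simp_all)
    then show ?thesis using False by (auto simp: coord simp del: inner_minus_left split: if_splits)
  qed
  have cheap: "c - u \<bullet> indicator_vec B \<le> sum (cost u) M" if "matching edges M" for M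
  proof -
    have "exchange B M \<in> ?\<T>" unfolding transversal_bases_eq using that by simp
    then show ?thesis using le tilted_height_exchange_le[OF that, of u] by fastforce
  qed
  have "0 \<le> c - u \<bullet> indicator_vec B"
  proof (rule minimum_cost_nonneg_if_every_vertex_missed[where c = "cost u", OF cheap])
    fix x
    obtain A where A: "A \<in> K" "x \<notin> (B - A) \<union> (A - B)" using missed by blast
    then obtain M where M: "matching edges M" "exchange B M = A"
      "u \<bullet> indicator_vec A + minor A = u \<bullet> indicator_vec B + sum (cost u) M"
      using tilted_height_attained[of A u] K by blast
    then show "\<exists>M. matching edges M \<and> sum (cost u) M = c - u \<bullet> indicator_vec B \<and> x \<notin> fst ` M \<union> snd ` M"
      using A K exchange_diff[OF M(1)] by (intro exI[of _ M]) auto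
  qed
  moreover have "c \<le> u \<bullet> indicator_vec B" using cheap[of "{}"] by simp
  ultimately show ?thesis by simp
qed

text \<open>
  With nonnegative reduced costs the empty matching is optimal, and a matching is optimal
  exactly if all its edges are tight.
\<close>
lemma tight_cell_bases:
  assumes le: "\<forall>e\<in>edges. 0 \<le> cost u e"
  shows "{A \<in> transversal_bases B V. u \<bullet> indicator_vec A + minor A = u \<bullet> indicator_vec B}
    = exchange B ` {M. matching {e \<in> edges. cost u e = 0} M}"
    and "\<forall>A\<in>transversal_bases B V. u \<bullet> indicator_vec B \<le> u \<bullet> indicator_vec A + minor A"
proof -
  have nonneg: "0 \<le> sum (cost u) M" if "matching edges M" for M
    using that le by (intro sum_nonneg) (auto simp: matching_def)
  show ge: "\<forall>A\<in>transversal_bases B V. u \<bullet> indicator_vec B \<le> u \<bullet> indicator_vec A + minor A"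
  proof
    fix A assume "A \<in> transversal_bases B V"
    then obtain M where "matching edges M"
      "u \<bullet> indicator_vec A + minor A = u \<bullet> indicator_vec B + sum (cost u) M"
      using tilted_height_attained[of A u] by blast
    then show "u \<bullet> indicator_vec B \<le> u \<bullet> indicator_vec A + minor A" using nonneg by simp
  qed
  show "{A \<in> transversal_bases B V. u \<bullet> indicator_vec A + minor A = u \<bullet> indicator_vec B}
    = exchange B ` {M. matching {e \<in> edges. cost u e = 0} M}"
  proof (intro equalityI subsetI)
    fix A assume A: "A \<in> {A \<in> transversal_bases B V. u \<bullet> indicator_vec A + minor A = u \<bullet> indicator_vec B}"
    then obtain M where M: "matching edges M" "exchange B M = A"
      "u \<bullet> indicator_vec A + minor A = u \<bullet> indicator_vec B + sum (cost u) M"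
      using tilted_height_attained[of A u] by blast
    then have "sum (cost u) M = 0" using A by simp
    then have "\<forall>e\<in>M. cost u e = 0"
      using M(1) le by (subst (asm) sum_nonneg_eq_0_iff) (auto simp: matching_def)
    then have "matching {e \<in> edges. cost u e = 0} M" using M(1) by (auto simp: matching_def)
    then show "A \<in> exchange B ` {M. matching {e \<in> edges. cost u e = 0} M}" using M(2) by blast
  next
    fix A assume "A \<in> exchange B ` {M. matching {e \<in> edges. cost u e = 0} M}"
    then obtain M where M: "matching {e \<in> edges. cost u e = 0} M" and A: "A = exchange B M" by auto
    have ME: "matching edges M" using M by (rule matching_mono) auto
    then have AT: "A \<in> transversal_bases B V" unfolding transversal_bases_eq A by simp
    have "sum (cost u) M = 0" using M by (intro sum.neutral) (auto simp: matching_def)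
    then have "u \<bullet> indicator_vec A + minor A \<le> u \<bullet> indicator_vec B"
      using tilted_height_exchange_le[OF ME, of u] A by simp
    then show "A \<in> {A \<in> transversal_bases B V. u \<bullet> indicator_vec A + minor A = u \<bullet> indicator_vec B}"
      using ge AT by fastforce
  qed
qed

lemma interior_basis_cells:
  "interior_faces (convex hull (indicator_vec ` transversal_bases B V))
      (regular_subdivision (transversal_bases B V) indicator_vec minor)
    = basis_cell ` {G. tight G \<and> \<not> on_boundary G}" (is "interior_faces ?P ?D = _")
proof (intro equalityI subsetI)
  fix F assume "F \<in> interior_faces ?P ?D"
  then obtain u c where le: "\<forall>A\<in>transversal_bases B V. c \<le> u \<bullet> indicator_vec A + minor A"
    and F: "F = convex hull (indicator_vec ` {A \<in> transversal_bases B V. u \<bullet> indicator_vec A + minor A = c})"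
    and int: "\<not> F \<subseteq> rel_frontier ?P"
    by (auto simp: interior_faces_def regular_subdivision_eq_convex_hulls)
  have c: "c = u \<bullet> indicator_vec B"
    using interior_cell_contains_B[OF le refl] int F by blast
  have cost: "\<forall>e\<in>edges. 0 \<le> cost u e"
  proof
    fix e assume e: "e \<in> edges"
    then have "exchange B {e} \<in> transversal_bases B V" unfolding transversal_bases_eq by simp
    then show "0 \<le> cost u e" using le c e tilted_height_exchange_le[of "{e}" u] by fastforce
  qed
  let ?G = "{e \<in> edges. cost u e = 0}"
  have FG: "F = basis_cell ?G" unfolding F c basis_cell_def tight_cell_bases(1)[OF cost] ..
  moreover have "tight ?G" unfolding tight_def using cost by blast
  moreover have "\<not> on_boundary ?G"
    using basis_cell_subset_rel_frontier_iff[of ?G] int FG by auto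
  ultimately show "F \<in> basis_cell ` {G. tight G \<and> \<not> on_boundary G}" by blast
next
  fix F assume "F \<in> basis_cell ` {G. tight G \<and> \<not> on_boundary G}"
  then obtain G where G: "tight G" "\<not> on_boundary G" and F: "F = basis_cell G" by blast
  then obtain u where u: "\<forall>e\<in>edges. 0 \<le> cost u e" "G = {e \<in> edges. cost u e = 0}"
    unfolding tight_def by blast
  have "F = convex hull (indicator_vec `
      {A \<in> transversal_bases B V. u \<bullet> indicator_vec A + minor A = u \<bullet> indicator_vec B})"
    unfolding F basis_cell_def tight_cell_bases(1)[OF u(1)] u(2) ..
  then have "F \<in> ?D"
    unfolding regular_subdivision_eq_convex_hulls[OF finite] using tight_cell_bases(2)[OF u(1)] by blast
  moreover have "\<not> F \<subseteq> rel_frontier ?P"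
    unfolding F using G basis_cell_subset_rel_frontier_iff tight_subset by blast
  ultimately show "F \<in> interior_faces ?P ?D" by (simp add: interior_faces_def)
qed

end

lemma poset_isomorphic_images:
  assumes "\<And>x y. x \<in> X \<Longrightarrow> y \<in> X \<Longrightarrow> f x \<subseteq> f y \<longleftrightarrow> x \<subseteq> y"
    and "\<And>x y. x \<in> X \<Longrightarrow> y \<in> X \<Longrightarrow> g x \<subseteq> g y \<longleftrightarrow> x \<subseteq> y"
  shows "poset_isomorphic (f ` X) (\<supseteq>) (g ` X) (\<supseteq>)"
proof -
  have f: "inj_on f X" by (intro inj_onI equalityI) (use assms(1) in blast)+
  have g: "inj_on g X" by (intro inj_onI equalityI) (use assms(2) in blast)+
  define h where "h = g \<circ> the_inv_into X f"
  have h: "h (f x) = g x" if "x \<in> X" for x using that f by (simp add: h_def the_inv_into_f_f)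
  have "bij_betw h (f ` X) (g ` X)"
    unfolding h_def using f g
    by (intro bij_betw_trans[OF bij_betw_the_inv_into]) (simp_all add: bij_betw_imageI)
  moreover have "\<forall>x\<in>f ` X. \<forall>y\<in>f ` X. y \<subseteq> x \<longleftrightarrow> h y \<subseteq> h x"
    using assms by (simp add: h)
  ultimately show ?thesis unfolding poset_isomorphic_def by blast
qed

theorem proposition4p1:
  fixes \<B> :: "'n::finite set set" and B :: "'n set" and m :: nat
    and V :: "'n \<Rightarrow> 'n \<Rightarrow> ereal"
  assumes "1 \<le> m" and "m < CARD('n)"
    and "matroid_bases m \<B>" and "B \<in> \<B>"
    and "vertex_figure \<B> B \<noteq> {}"
    and "\<And>i j. i \<in> B \<Longrightarrow> j \<notin> B \<Longrightarrow> V i j \<noteq> -\<infinity>"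
    and "\<And>i j. i \<in> B \<Longrightarrow> j \<notin> B \<Longrightarrow> V i j \<noteq> \<infinity> \<longleftrightarrow> insert j (B - {i}) \<in> \<B>"
  shows "poset_isomorphic
           (interior_faces (vertex_figure \<B> B) (vertex_figure_subdivision \<B> B V)) (\<supseteq>)
           (interior_faces (matroid_polytope (transversal_bases B V)) (transversal_subdivision B V)) (\<supseteq>)"
proof -
  interpret exchange_graph B V using assms(6) by unfold_locales
  have pairs: "exchange_pairs \<B> B = edges"
    using assms(7) by (auto simp: exchange_pairs_def edges_def)
  have figure: "vertex_figure \<B> B = convex hull (exchange_vertex B ` edges)"
    using vertex_figure_eq_exchange[OF assms(3,4)] pairs by simp
  have ne: "edges \<noteq> {}" using assms(5) figure by auto
  let ?X = "{G. tight G \<and> \<not> on_boundary G}"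
  have S: "interior_faces (vertex_figure \<B> B) (vertex_figure_subdivision \<B> B V) = figure_cell ` ?X"
    unfolding figure vertex_figure_subdivision_def pairs
    using interior_figure_cells[OF ne] by (simp add: weight_def)
  have D: "interior_faces (matroid_polytope (transversal_bases B V)) (transversal_subdivision B V)
      = basis_cell ` ?X"
    unfolding matroid_polytope_def transversal_subdivision_def by (rule interior_basis_cells)
  show ?thesis
    unfolding S D
    by (intro poset_isomorphic_images figure_cell_subset_iff basis_cell_subset_iff) (auto dest: tight_subset)
qed

end
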